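(* Let $a \in \mathbb{N}\setminus\{0\}$. The plane curve $\mathcal{X}_{a,a+1,U} \subset \mathbb{C}^2$ is hyperbolic with respect to the origin, in the sense that all intersection points of the curve with any real line passing through the origin (i.e. any line $\{\alpha x-\beta y=0\}$ with $(\alpha,\beta)\in\mathbb{R}^2\setminus\{(0,0)\}$) are real.
   Context: The Chebyshev polynomials of the second kind are defined by $U_0(t)=1$, $U_1(t)=2t$, $U_{k+1}(t)=2t\,U_k(t)-U_{k-1}(t)$. For $a,b\in\mathbb{N}$, $\mathcal{X}_{a,b,U}\subset\mathbb{C}^2$ denotes the Zariski closure of the image of the map $\mathbb{C}\to\mathbb{C}^2$, $t\mapsto (U_a(t),U_b(t))$; coordinates on $\mathbb{C}^2$ are $(x,y)$. A point of $\mathbb{C}^2$ is real if it lies in $\mathbb{R}^2$. *)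

theory Defs
  imports Complex_Main "HOL-Computational_Algebra.Computational_Algebra"
begin

fun cheb_U :: "nat \<Rightarrow> 'a::comm_ring_1 poly" where
  "cheb_U 0 = 1"
| "cheb_U (Suc 0) = [:0, 2:]"
| "cheb_U (Suc (Suc k)) = [:0, 2:] * cheb_U (Suc k) - cheb_U k"

text \<open>
  A bivariate polynomial is an element of \<open>\<complex>[x][y]\<close>, represented by the type
  \<open>complex poly poly\<close>: the inner variable is \<open>x\<close>, the outer one is \<open>y\<close>.
\<close>

definition eval2 :: "'a::comm_ring_1 poly poly \<Rightarrow> 'a \<times> 'a \<Rightarrow> 'a" where
  "eval2 f = (\<lambda>(x, y). poly (poly f [:y:]) x)"

definition zero_locus :: "'a::comm_ring_1 poly poly set \<Rightarrow> ('a \<times> 'a) set" where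
  "zero_locus F = {p. \<forall>f\<in>F. eval2 f p = 0}"

definition zariski_closed :: "('a::comm_ring_1 \<times> 'a) set \<Rightarrow> bool" where
  "zariski_closed S \<longleftrightarrow> (\<exists>F. S = zero_locus F)"

definition zariski_closure :: "('a::comm_ring_1 \<times> 'a) set \<Rightarrow> ('a \<times> 'a) set" where
  "zariski_closure S = zariski_closed hull S"

text \<open>The hull is itself Zariski closed, so it is the smallest closed superset.\<close>

lemma zero_locus_Union: "zero_locus (\<Union>\<F>) = \<Inter>(zero_locus ` \<F>)"
  by (auto simp: zero_locus_def)

lemma zariski_closed_Inter:
  assumes "\<And>S. S \<in> T \<Longrightarrow> zariski_closed S"
  shows "zariski_closed (\<Inter>T)"
proof -
  have "\<forall>S\<in>T. \<exists>F. S = zero_locus F"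
    using assms by (auto simp: zariski_closed_def)
  then obtain F where F: "\<forall>S\<in>T. S = zero_locus (F S)"
    by metis
  then have "\<Inter>T = zero_locus (\<Union>(F ` T))"
    by (auto simp: zero_locus_Union)
  then show ?thesis
    unfolding zariski_closed_def by blast
qed

lemma zariski_closed_zariski_closure: "zariski_closed (zariski_closure S)"
  unfolding zariski_closure_def by (rule hull_in) (blast intro: zariski_closed_Inter)

definition cheb_curve_U :: "nat \<Rightarrow> nat \<Rightarrow> (complex \<times> complex) set" where
  "cheb_curve_U a b = zariski_closure (range (\<lambda>t. (poly (cheb_U a) t, poly (cheb_U b) t)))"

definition line_through_origin :: "real \<Rightarrow> real \<Rightarrow> (complex \<times> complex) set" where
  "line_through_origin \<alpha> \<beta> = {(x, y). complex_of_real \<alpha> * x - complex_of_real \<beta> * y = 0}"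

definition real_points :: "(complex \<times> complex) set" where
  "real_points = \<real> \<times> \<real>"

definition hyperbolic_wrt_origin :: "(complex \<times> complex) set \<Rightarrow> bool" where
  "hyperbolic_wrt_origin C \<longleftrightarrow>
     (\<forall>\<alpha> \<beta>. (\<alpha>, \<beta>) \<noteq> (0, 0) \<longrightarrow> C \<inter> line_through_origin \<alpha> \<beta> \<subseteq> real_points)"

end

theory Submission
  imports Defs "HOL-Computational_Algebra.Field_as_Ring" "Subresultants.Subresultant_Gcd"
begin

text \<open>
  Restricting a linear form through the origin to the parametrisation
  \<open>t \<mapsto> (U\<^sub>a(t), U\<^sub>a\<^sub>+\<^sub>1(t))\<close> gives a real combination of two consecutive members of a family of
  orthogonal polynomials, and such a combination has only real roots. This is read off from the
  Christoffel--Darboux identity \<open>cheb_U_christoffel_darboux\<close> at \<open>s = cnj t\<close>: its sum becomes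
  \<open>\<Sum>k\<le>a. \<bar>U\<^sub>k(t)\<bar>\<^sup>2\<close>, which is at least \<open>\<bar>U\<^sub>0(t)\<bar>\<^sup>2 = 1\<close>, while its other side vanishes when
  \<open>(U\<^sub>a(t), U\<^sub>a\<^sub>+\<^sub>1(t))\<close> lies on a real line through the origin. So \<open>t\<close> equals \<open>cnj t\<close>, and the
  polynomials \<open>U\<^sub>k\<close>, having integer coefficients, take real values there.

  This argument applies to points of the image of the parametrisation, and the curve is
  the Zariski closure of that image. The closure adds nothing
  (\<open>zariski_closure_polynomial_curve\<close>): the resultant of \<open>p(t) - x\<close> and \<open>q(t) - y\<close> with respect to
  \<open>t\<close> is a polynomial in \<open>x, y\<close> that, for nonconstant \<open>p\<close>, vanishes exactly where these have a
  common root \<open>t\<close>, that is, on the image.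
\<close>

lemma eval2_comm_ring_hom: "comm_ring_hom (\<lambda>f. eval2 f z)"
  by unfold_locales (simp_all add: eval2_def split: prod.split)

lemma degree_diff_const: "degree (p - [:c:]) = degree (p :: 'a::comm_ring_1 poly)"
  by (cases p) (simp add: degree_pCons_eq_if)

text \<open>
  The constant term \<open>x\<close> or \<open>y\<close> does not affect degrees in \<open>t\<close>, even when \<open>q\<close> is constant, so
  the resultant over \<open>\<complex>[x][y]\<close> specialises correctly at every point. The hypothesis on \<open>p\<close> ensures
  that the gcd at a point is not the zero polynomial, whose degree is \<open>0\<close> although it has roots.
\<close>

lemma zariski_closed_polynomial_curve:
  fixes p q :: "complex poly"
  assumes "degree p \<noteq> 0"
  shows "zariski_closed (range (\<lambda>t. (poly p t, poly q t)))"
proof -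
  \<comment> \<open>\<open>P = p(t) - x\<close> and \<open>Q = q(t) - y\<close> as polynomials in \<open>t\<close> over \<open>\<complex>[x][y]\<close>\<close>
  define \<iota> :: "complex poly \<Rightarrow> complex poly poly poly" where "\<iota> = map_poly (\<lambda>c. [:[:c:]:])"
  define P where "P = \<iota> p - [:[:[:0, 1:]:]:]"
  define Q where "Q = \<iota> q - [:[:0, 1:]:]"
  have eval_resultant: "eval2 (resultant P Q) (x, y) = resultant (p - [:x:]) (q - [:y:])" for x y
  proof -
    interpret ev: comm_ring_hom "\<lambda>f. eval2 f (x, y)"
      by (rule eval2_comm_ring_hom)
    interpret ev_poly: map_poly_comm_ring_hom "\<lambda>f. eval2 f (x, y)" ..
    have \<iota>: "map_poly (\<lambda>f. eval2 f (x, y)) (\<iota> r) = r" "degree (\<iota> r) = degree r" for r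
      by (auto intro: poly_eqI simp: \<iota>_def coeff_map_poly eval2_def degree_map_poly)
    have P: "map_poly (\<lambda>f. eval2 f (x, y)) P = p - [:x:]"
      unfolding P_def ev_poly.hom_minus \<iota> by (simp add: eval2_def)
    have Q: "map_poly (\<lambda>f. eval2 f (x, y)) Q = q - [:y:]"
      unfolding Q_def ev_poly.hom_minus \<iota> by (simp add: eval2_def)
    show ?thesis
      using ev.resultant_map_poly[of P Q] unfolding P Q
      by (simp add: P_def Q_def degree_diff_const \<iota>)
  qed
  have common_root: "resultant (p - [:x:]) (q - [:y:]) = 0 \<longleftrightarrow> (\<exists>t. poly p t = x \<and> poly q t = y)"
    for x y
  proof -
    let ?g = "gcd (p - [:x:]) (q - [:y:])"
    have "p - [:x:] \<noteq> 0"
      using assms degree_diff_const[of p x] by auto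
    then have "?g \<noteq> 0"
      by simp
    have "degree ?g \<noteq> 0 \<longleftrightarrow> (\<exists>t. poly ?g t = 0)"
    proof
      assume "degree ?g \<noteq> 0"
      then show "\<exists>t. poly ?g t = 0"
        using fundamental_theorem_of_algebra constant_degree by metis
    next
      assume "\<exists>t. poly ?g t = 0"
      then show "degree ?g \<noteq> 0"
        using \<open>?g \<noteq> 0\<close> by (metis degree_eq_zeroE pCons_eq_0_iff poly_const_conv)
    qed
    also have "\<dots> \<longleftrightarrow> (\<exists>t. poly (p - [:x:]) t = 0 \<and> poly (q - [:y:]) t = 0)"
      unfolding poly_eq_0_iff_dvd gcd_greatest_iff ..
    also have "\<dots> \<longleftrightarrow> (\<exists>t. poly p t = x \<and> poly q t = y)"
      by simp
    finally show ?thesis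
      unfolding resultant_0_gcd .
  qed
  have "range (\<lambda>t. (poly p t, poly q t)) = zero_locus {resultant P Q}"
    by (auto simp: zero_locus_def eval_resultant common_root)
  then show ?thesis
    unfolding zariski_closed_def by blast
qed

lemma zariski_closure_polynomial_curve:
  fixes p q :: "complex poly"
  assumes "degree p \<noteq> 0"
  shows "zariski_closure (range (\<lambda>t. (poly p t, poly q t))) = range (\<lambda>t. (poly p t, poly q t))"
  unfolding zariski_closure_def
  by (rule hull_same) (rule zariski_closed_polynomial_curve[OF assms])

lemma degree_cheb_U: "degree (cheb_U n :: 'a::{idom, ring_char_0} poly) = n"
proof (induction n rule: cheb_U.induct)
  case (3 k)
  have "cheb_U (Suc k) \<noteq> (0 :: 'a poly)"
    using "3.IH"(1) by auto
  then have "degree ([:0, 2:] * cheb_U (Suc k) :: 'a poly) = Suc (Suc k)"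
    by (subst degree_mult_eq) (simp_all add: "3.IH")
  then show ?case
    unfolding cheb_U.simps(3) diff_conv_add_uminus
    by (subst degree_add_eq_left) (simp_all add: "3.IH"(2) del: mult_pCons_left)
qed simp_all

lemma poly_cheb_U_cnj: "poly (cheb_U n) (cnj t) = cnj (poly (cheb_U n) t)"
  by (induction n rule: cheb_U.induct) simp_all

text \<open>
  The right-hand side is antisymmetric in \<open>s\<close> and \<open>t\<close>. Expanding \<open>U\<^sub>n\<^sub>+\<^sub>1\<close> in it by the three-term
  recurrence gives \<open>2 (t - s) U\<^sub>n(t) U\<^sub>n(s)\<close> plus the same expression with \<open>n - 1\<close> in place of \<open>n\<close>,
  so it is a telescoping sum.
\<close>

lemma cheb_U_christoffel_darboux:
  fixes s t :: "'a::comm_ring_1"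
  shows "2 * (t - s) * (\<Sum>k\<le>n. poly (cheb_U k) t * poly (cheb_U k) s) =
         poly (cheb_U (Suc n)) t * poly (cheb_U n) s - poly (cheb_U n) t * poly (cheb_U (Suc n)) s"
proof (induction n)
  case 0
  show ?case by (simp add: algebra_simps)
next
  case (Suc n)
  show ?case
    unfolding sum.atMost_Suc distrib_left Suc.IH by (simp add: algebra_simps)
qed

text \<open>
  The hypothesis says that \<open>U\<^sub>n\<^sub>+\<^sub>1(t) cnj(U\<^sub>n(t))\<close> is real, which is what a point on a real line
  through the origin satisfies, whichever of its two coefficients is nonzero.
\<close>

lemma cheb_U_real_parameter:
  assumes "poly (cheb_U (Suc n)) t * cnj (poly (cheb_U n) t) =
           poly (cheb_U n) t * cnj (poly (cheb_U (Suc n)) t)"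
  shows "t \<in> \<real>"
proof -
  define S where "S = (\<Sum>k\<le>n. (cmod (poly (cheb_U k) t))\<^sup>2)"
  have "(cmod (poly (cheb_U 0) t))\<^sup>2 \<le> S"
    unfolding S_def by (rule member_le_sum) auto
  then have "S \<noteq> 0"
    by auto
  have "complex_of_real S = (\<Sum>k\<le>n. poly (cheb_U k) t * poly (cheb_U k) (cnj t))"
    by (simp add: S_def poly_cheb_U_cnj complex_norm_square del: of_real_power)
  then have "2 * (t - cnj t) * complex_of_real S = 0"
    using cheb_U_christoffel_darboux[of t "cnj t" n] assms by (simp add: poly_cheb_U_cnj)
  then have "cnj t = t"
    using \<open>S \<noteq> 0\<close> by simp
  then show ?thesis
    by (simp add: Reals_cnj_iff)
qed

theorem theorem3p8:
  fixes a :: nat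
  assumes "a \<noteq> 0"
  shows "hyperbolic_wrt_origin (cheb_curve_U a (a + 1))"
  unfolding hyperbolic_wrt_origin_def
proof (intro allI impI subsetI)
  fix \<alpha> \<beta> :: real and z :: "complex \<times> complex"
  assume nonzero: "(\<alpha>, \<beta>) \<noteq> (0, 0)"
    and z: "z \<in> cheb_curve_U a (a + 1) \<inter> line_through_origin \<alpha> \<beta>"
  have "cheb_curve_U a (a + 1) = range (\<lambda>t. (poly (cheb_U a) t, poly (cheb_U (Suc a)) t))"
    using assms unfolding cheb_curve_U_def
    by (simp add: zariski_closure_polynomial_curve degree_cheb_U)
  then obtain t where t: "z = (poly (cheb_U a) t, poly (cheb_U (Suc a)) t)"
    using z by auto
  define x y where "x = poly (cheb_U a) t" and "y = poly (cheb_U (Suc a)) t"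
  have line: "complex_of_real \<alpha> * x = complex_of_real \<beta> * y"
    using z unfolding t line_through_origin_def x_def y_def by simp
  then have line_cnj: "complex_of_real \<alpha> * cnj x = complex_of_real \<beta> * cnj y"
    by (metis complex_cnj_complex_of_real complex_cnj_mult)
  have "complex_of_real \<alpha> * (y * cnj x - x * cnj y) = 0"
  proof -
    have "complex_of_real \<alpha> * (y * cnj x - x * cnj y) =
          y * (complex_of_real \<alpha> * cnj x) - (complex_of_real \<alpha> * x) * cnj y"
      by (simp add: algebra_simps)
    also have "\<dots> = 0"
      unfolding line line_cnj by simp
    finally show ?thesis .
  qed
  moreover have "complex_of_real \<beta> * (y * cnj x - x * cnj y) = 0"
  proof -
    have "complex_of_real \<beta> * (y * cnj x - x * cnj y) =
          (complex_of_real \<beta> * y) * cnj x - x * (complex_of_real \<beta> * cnj y)"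
      by (simp add: algebra_simps)
    also have "\<dots> = 0"
      unfolding line[symmetric] line_cnj[symmetric] by simp
    finally show ?thesis .
  qed
  ultimately have "y * cnj x = x * cnj y"
    using nonzero by auto
  then have "t \<in> \<real>"
    using cheb_U_real_parameter[of a t] by (simp add: x_def y_def)
  then have "poly (cheb_U k) t \<in> \<real>" for k
    using poly_cheb_U_cnj[of k t] by (simp add: Reals_cnj_iff)
  then show "z \<in> real_points"
    by (simp add: t real_points_def del: cheb_U.simps)
qed

end
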